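(* Let $L_2=\langle a,t \mid a^2,\ [t^{i}at^{-i},t^{j}at^{-j}],\ i,j\in\mathbb{Z}\rangle$. Then $L_2$ has no regular language of geodesics with respect to the generating set $\{t,ta\}$.
   Context: $L_2$ is the lamplighter group, i.e. the wreath product $\mathbb{Z}_2\wr\mathbb{Z}$, where $a$ generates $\mathbb{Z}_2$ and $t$ generates $\mathbb{Z}$; $\{t,ta\}$ is called its automata generating set, and $ta$ is treated as a single letter. For a group $G$ with finite generating set $X$, words are finite strings over the alphabet $X\cup X^{-1}$; a word is geodesic if its length equals the word length (with respect to $X$) of the element of $G$ it represents. A language of geodesics for $G$ with respect to $X$ is a set of geodesic words that contains at least one representative of each element of $G$. A language is regular if it is accepted by a finite state automaton. *)

theory Defs
  imports "HOL-Algebra.Generated_Groups"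
begin

subsection \<open>Groups given by generators and relators\<close>

datatype 'g sletter = Gen 'g | Inv 'g

fun flip :: "'g sletter \<Rightarrow> 'g sletter" where
  "flip (Gen x) = Inv x"
| "flip (Inv x) = Gen x"

definition inv_word :: "'g sletter list \<Rightarrow> 'g sletter list" where
  "inv_word w = rev (map flip w)"

definition gen_power :: "'g \<Rightarrow> int \<Rightarrow> 'g sletter list" where
  "gen_power x i = replicate (nat \<bar>i\<bar>) (if i < 0 then Inv x else Gen x)"

definition commutator_word :: "'g sletter list \<Rightarrow> 'g sletter list \<Rightarrow> 'g sletter list" where
  "commutator_word u v = u @ v @ inv_word u @ inv_word v"

text \<open>The congruence on words generated by free cancellation and by deleting relators.
  The classes of this congruence are the elements of the presented group, whose generators
  are all elements of the type \<^typ>\<open>'g\<close>.\<close>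

inductive pres_eq :: "'g sletter list set \<Rightarrow> 'g sletter list \<Rightarrow> 'g sletter list \<Rightarrow> bool"
  for R :: "'g sletter list set" where
  refl: "pres_eq R u u"
| sym: "pres_eq R u v \<Longrightarrow> pres_eq R v u"
| trans: "pres_eq R u v \<Longrightarrow> pres_eq R v w \<Longrightarrow> pres_eq R u w"
| cancel: "pres_eq R (u @ [x, flip x] @ v) (u @ v)"
| relator: "r \<in> R \<Longrightarrow> pres_eq R (u @ r @ v) (u @ v)"

definition pres_class :: "'g sletter list set \<Rightarrow> 'g sletter list \<Rightarrow> 'g sletter list set" where
  "pres_class R u = {v. pres_eq R u v}"

definition presented_group :: "'g sletter list set \<Rightarrow> 'g sletter list set monoid" where
  "presented_group R =
     \<lparr> carrier = range (pres_class R),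
       monoid.mult = (\<lambda>C D. \<Union>u\<in>C. \<Union>v\<in>D. pres_class R (u @ v)),
       monoid.one = pres_class R [] \<rparr>"

lemma flip_flip [simp]: "flip (flip x) = x"
  by (cases x) auto

lemma pres_eq_append:
  assumes "pres_eq R u u'" and "pres_eq R v v'"
  shows "pres_eq R (u @ v) (u' @ v')"
proof -
  have l: "pres_eq R (u @ w) (u' @ w)" for w
    using assms(1)
  proof induction
    case (refl u)
    show ?case by (rule pres_eq.refl)
  next
    case (sym u v)
    show ?case using sym.IH by (rule pres_eq.sym)
  next
    case (trans u v v')
    show ?case using trans.IH by (rule pres_eq.trans)
  next
    case (cancel u x v)
    show ?case using pres_eq.cancel[of R u x "v @ w"] by simp
  next
    case (relator r u v)
    then show ?case using pres_eq.relator[of r R u "v @ w"] by simp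
  qed
  have r: "pres_eq R (w @ v) (w @ v')" for w
    using assms(2)
  proof induction
    case (refl v)
    show ?case by (rule pres_eq.refl)
  next
    case (sym u v)
    show ?case using sym.IH by (rule pres_eq.sym)
  next
    case (trans u v v')
    show ?case using trans.IH by (rule pres_eq.trans)
  next
    case (cancel u x v)
    show ?case using pres_eq.cancel[of R "w @ u" x v] by simp
  next
    case (relator r u v)
    then show ?case using pres_eq.relator[of r R "w @ u" v] by simp
  qed
  show ?thesis using l r by (rule pres_eq.trans)
qed

lemma pres_class_eq_iff: "pres_class R u = pres_class R v \<longleftrightarrow> pres_eq R u v"
proof
  assume eq: "pres_class R u = pres_class R v"
  have "v \<in> pres_class R u"
    unfolding eq by (simp add: pres_class_def pres_eq.refl)
  then show "pres_eq R u v"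
    by (simp add: pres_class_def)
next
  assume uv: "pres_eq R u v"
  then have "pres_eq R u w \<longleftrightarrow> pres_eq R v w" for w
    by (metis pres_eq.sym pres_eq.trans)
  then show "pres_class R u = pres_class R v"
    by (simp add: pres_class_def)
qed

lemma pres_class_mult:
  "pres_class R u \<otimes>\<^bsub>presented_group R\<^esub> pres_class R v = pres_class R (u @ v)"
proof -
  have "pres_class R (u' @ v') = pres_class R (u @ v)"
    if "u' \<in> pres_class R u" "v' \<in> pres_class R v" for u' v'
  proof -
    have "pres_eq R u u'" "pres_eq R v v'"
      using that by (simp_all add: pres_class_def)
    then show ?thesis
      unfolding pres_class_eq_iff by (intro pres_eq.sym[OF pres_eq_append])
  qed
  moreover have "u \<in> pres_class R u" "v \<in> pres_class R v"
    by (auto simp: pres_class_def pres_eq.refl)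
  ultimately have "(\<Union>u'\<in>pres_class R u. \<Union>v'\<in>pres_class R v. pres_class R (u' @ v'))
      = pres_class R (u @ v)"
    by blast
  then show ?thesis
    by (simp add: presented_group_def)
qed

lemma inv_word_cancel: "pres_eq R (inv_word w @ w) []"
proof (induction w)
  case Nil
  show ?case by (simp add: inv_word_def pres_eq.refl)
next
  case (Cons x w)
  have "pres_eq R (inv_word w @ [flip x, flip (flip x)] @ w) (inv_word w @ w)"
    by (rule pres_eq.cancel)
  then have "pres_eq R (inv_word w @ [flip x, flip (flip x)] @ w) []"
    using Cons.IH by (rule pres_eq.trans)
  then show ?case
    by (simp add: inv_word_def)
qed

lemma group_presented_group: "group (presented_group R)"
proof (rule groupI)
  fix C assume "C \<in> carrier (presented_group R)"
  then obtain w where w: "C = pres_class R w"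
    by (auto simp: presented_group_def)
  have one: "\<one>\<^bsub>presented_group R\<^esub> = pres_class R []"
    by (simp add: presented_group_def)
  show "\<one>\<^bsub>presented_group R\<^esub> \<otimes>\<^bsub>presented_group R\<^esub> C = C"
    by (simp add: w one pres_class_mult)
  show "\<exists>D\<in>carrier (presented_group R). D \<otimes>\<^bsub>presented_group R\<^esub> C = \<one>\<^bsub>presented_group R\<^esub>"
  proof
    show "pres_class R (inv_word w) \<otimes>\<^bsub>presented_group R\<^esub> C = \<one>\<^bsub>presented_group R\<^esub>"
      by (simp add: w one pres_class_mult pres_class_eq_iff inv_word_cancel)
  qed (simp add: presented_group_def)
next
  fix C D assume "C \<in> carrier (presented_group R)" "D \<in> carrier (presented_group R)"
  then obtain u v where "C = pres_class R u" "D = pres_class R v"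
    by (auto simp: presented_group_def)
  then have "C \<otimes>\<^bsub>presented_group R\<^esub> D = pres_class R (u @ v)"
    by (simp add: pres_class_mult)
  then show "C \<otimes>\<^bsub>presented_group R\<^esub> D \<in> carrier (presented_group R)"
    by (simp add: presented_group_def)
next
  fix C D E
  assume "C \<in> carrier (presented_group R)" "D \<in> carrier (presented_group R)"
    "E \<in> carrier (presented_group R)"
  then obtain u v w where "C = pres_class R u" "D = pres_class R v" "E = pres_class R w"
    by (auto simp: presented_group_def)
  then show "C \<otimes>\<^bsub>presented_group R\<^esub> D \<otimes>\<^bsub>presented_group R\<^esub> E
      = C \<otimes>\<^bsub>presented_group R\<^esub> (D \<otimes>\<^bsub>presented_group R\<^esub> E)"
    by (simp add: pres_class_mult)
qed (simp add: presented_group_def)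


subsection \<open>The lamplighter group\<close>

datatype lamp_gen = A | T

definition lamp_conj :: "int \<Rightarrow> lamp_gen sletter list" where
  "lamp_conj i = gen_power T i @ [Gen A] @ gen_power T (- i)"

definition lamp_relators :: "lamp_gen sletter list set" where
  "lamp_relators =
     insert [Gen A, Gen A] (range (\<lambda>(i, j). commutator_word (lamp_conj i) (lamp_conj j)))"

definition L2 :: "lamp_gen sletter list set monoid" where
  "L2 = presented_group lamp_relators"

definition L2_a :: "lamp_gen sletter list set" where
  "L2_a = pres_class lamp_relators [Gen A]"

definition L2_t :: "lamp_gen sletter list set" where
  "L2_t = pres_class lamp_relators [Gen T]"

definition automata_gens :: "lamp_gen sletter list set set" where
  "automata_gens = {L2_t, L2_t \<otimes>\<^bsub>L2\<^esub> L2_a}"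

lemma group_L2: "group L2"
  unfolding L2_def by (rule group_presented_group)

lemma automata_gens_generate: "generate L2 automata_gens = carrier L2"
proof -
  interpret group L2 by (rule group_L2)
  have cls: "pres_class lamp_relators w \<in> carrier L2" for w
    by (simp add: L2_def presented_group_def)
  have mult: "pres_class lamp_relators u \<otimes>\<^bsub>L2\<^esub> pres_class lamp_relators v
      = pres_class lamp_relators (u @ v)" for u v
    by (simp add: L2_def pres_class_mult)
  have ta: "L2_t \<in> carrier L2" "L2_a \<in> carrier L2"
    by (simp_all add: L2_t_def L2_a_def cls)
  then have sub: "automata_gens \<subseteq> carrier L2"
    by (auto simp: automata_gens_def)
  let ?H = "generate L2 automata_gens"
  have sg: "subgroup ?H L2"
    by (rule generate_is_subgroup[OF sub])
  have tH: "L2_t \<in> ?H" and taH: "L2_t \<otimes>\<^bsub>L2\<^esub> L2_a \<in> ?H"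
    by (auto simp: automata_gens_def intro: generate.incl)
  have "inv\<^bsub>L2\<^esub> L2_t \<otimes>\<^bsub>L2\<^esub> (L2_t \<otimes>\<^bsub>L2\<^esub> L2_a) \<in> ?H"
    using sg tH taH by (simp add: subgroup.m_closed subgroup.m_inv_closed)
  then have aH: "L2_a \<in> ?H"
    using ta by (simp add: m_assoc[symmetric])
  have one: "\<one>\<^bsub>L2\<^esub> = pres_class lamp_relators []"
    by (simp add: L2_def presented_group_def)
  have gen: "pres_class lamp_relators [Gen x] \<in> ?H" for x
    using aH tH by (cases x) (simp_all add: L2_a_def L2_t_def)
  have neg: "pres_class lamp_relators [Inv x] \<in> ?H" for x
  proof -
    have "pres_class lamp_relators [Inv x] \<otimes>\<^bsub>L2\<^esub> pres_class lamp_relators [Gen x] = \<one>\<^bsub>L2\<^esub>"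
      using pres_eq.cancel[of lamp_relators "[]" "Inv x" "[]"]
      by (simp add: mult one pres_class_eq_iff)
    then have "pres_class lamp_relators [Inv x] = inv\<^bsub>L2\<^esub> (pres_class lamp_relators [Gen x])"
      by (simp add: cls inv_equality)
    then show ?thesis
      using sg gen by (simp add: subgroup.m_inv_closed)
  qed
  have "pres_class lamp_relators w \<in> ?H" for w
  proof (induction w)
    case Nil
    show ?case using generate.one[of L2] by (simp add: one)
  next
    case (Cons x w)
    have "pres_class lamp_relators [x] \<in> ?H"
      using gen neg by (cases x) auto
    then have "pres_class lamp_relators [x] \<otimes>\<^bsub>L2\<^esub> pres_class lamp_relators w \<in> ?H"
      using Cons sg by (simp add: subgroup.m_closed)
    then show ?case by (simp add: mult)
  qed
  then have "carrier L2 \<subseteq> ?H"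
    by (auto simp: L2_def presented_group_def)
  moreover have "?H \<subseteq> carrier L2"
    using sg by (rule subgroup.subset)
  ultimately show ?thesis by simp
qed


subsection \<open>Words, geodesics and languages of geodesics\<close>

definition alphabet :: "('a, 'b) monoid_scheme \<Rightarrow> 'a set \<Rightarrow> 'a set" where
  "alphabet G X = X \<union> (\<lambda>x. inv\<^bsub>G\<^esub> x) ` X"

definition word_value :: "('a, 'b) monoid_scheme \<Rightarrow> 'a list \<Rightarrow> 'a" where
  "word_value G w = foldr (\<lambda>x y. x \<otimes>\<^bsub>G\<^esub> y) w \<one>\<^bsub>G\<^esub>"

definition word_length :: "('a, 'b) monoid_scheme \<Rightarrow> 'a set \<Rightarrow> 'a \<Rightarrow> nat" where
  "word_length G X g =
     (LEAST n. \<exists>w \<in> lists (alphabet G X). word_value G w = g \<and> length w = n)"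

definition geodesic :: "('a, 'b) monoid_scheme \<Rightarrow> 'a set \<Rightarrow> 'a list \<Rightarrow> bool" where
  "geodesic G X w \<longleftrightarrow>
     w \<in> lists (alphabet G X) \<and> length w = word_length G X (word_value G w)"

definition language_of_geodesics :: "('a, 'b) monoid_scheme \<Rightarrow> 'a set \<Rightarrow> 'a list set \<Rightarrow> bool" where
  "language_of_geodesics G X L \<longleftrightarrow>
     (\<forall>w\<in>L. geodesic G X w) \<and> (\<forall>g\<in>carrier G. \<exists>w\<in>L. word_value G w = g)"


subsection \<open>Finite state automata\<close>

text \<open>Automata may be nondeterministic. States are natural numbers, which is no restriction
  since a finite state set can be renumbered.\<close>

record 'a fsa =
  states :: "nat set"
  start :: nat
  accepting :: "nat set"
  edges :: "(nat \<times> 'a \<times> nat) set"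

definition is_fsa :: "'a set \<Rightarrow> 'a fsa \<Rightarrow> bool" where
  "is_fsa \<Sigma> M \<longleftrightarrow>
     finite (states M) \<and> start M \<in> states M \<and> accepting M \<subseteq> states M
     \<and> edges M \<subseteq> states M \<times> \<Sigma> \<times> states M"

fun run :: "'a fsa \<Rightarrow> nat \<Rightarrow> 'a list \<Rightarrow> nat \<Rightarrow> bool" where
  "run M p [] q \<longleftrightarrow> p = q"
| "run M p (x # w) q \<longleftrightarrow> (\<exists>r. (p, x, r) \<in> edges M \<and> run M r w q)"

definition accepted_language :: "'a fsa \<Rightarrow> 'a list set" where
  "accepted_language M = {w. \<exists>q \<in> accepting M. run M (start M) w q}"

definition regular_language :: "'a set \<Rightarrow> 'a list set \<Rightarrow> bool" where
  "regular_language \<Sigma> L \<longleftrightarrow> (\<exists>M. is_fsa \<Sigma> M \<and> accepted_language M = L)"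

end

theory Submission imports Defs begin

text \<open>The letters \<open>t\<close> and \<open>ta\<close> both cross an edge of the integer line, the second one
  switching the lamp on that edge, so the length of an element is the length of a shortest path
  from 0 to the final position that crosses all lit edges. Lighting the edges at both ends of
  \<open>[-m, n]\<close> and finishing at 1 forces every geodesic to start with \<open>m\<close> steps to the left, which
  can be pumped. Pumping moves the final position to the negative side, where visiting the right
  end first gives a strictly shorter path.\<close>

subsection \<open>Lamp configurations\<close>

text \<open>A pair consists of the set of lit lamps and the position of the lamplighter. In the words
  over the automata generators, lamp \<open>i\<close> sits on the edge between \<open>i - 1\<close> and \<open>i\<close>.\<close>

type_synonym lamps = "(int \<Rightarrow> bool) \<times> int"

text \<open>Multiplication of the wreath product: the second configuration is read relative to the
  position reached by the first, and \<open>\<noteq>\<close> adds lamps modulo 2.\<close>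

definition lmul :: "lamps \<Rightarrow> lamps \<Rightarrow> lamps" where
  "lmul x y = (\<lambda>i. fst x i \<noteq> fst y (i - snd x), snd x + snd y)"

definition lone :: lamps where
  "lone = (\<lambda>_. False, 0)"

definition lval :: "lamps list \<Rightarrow> lamps" where
  "lval w = foldr lmul w lone"

lemma lmul_assoc: "lmul (lmul x y) z = lmul x (lmul y z)"
  by (auto simp: lmul_def fun_eq_iff algebra_simps)

lemma lmul_lone [simp]: "lmul lone x = x" "lmul x lone = x"
  by (auto simp: lmul_def lone_def)

lemma lval_Nil [simp]: "lval [] = lone"
  and lval_Cons [simp]: "lval (x # w) = lmul x (lval w)"
  by (simp_all add: lval_def)

lemma lval_append: "lval (u @ v) = lmul (lval u) (lval v)"
  by (induction u) (simp_all add: lmul_assoc)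

lemma snd_lmul [simp]: "snd (lmul x y) = snd x + snd y"
  by (simp add: lmul_def)

lemma fst_lmul: "fst (lmul x y) i \<longleftrightarrow> fst x i \<noteq> fst y (i - snd x)"
  by (simp add: lmul_def)

fun lgen :: "lamp_gen sletter \<Rightarrow> lamps" where
  "lgen (Gen A) = (\<lambda>i. i = 0, 0)"
| "lgen (Inv A) = (\<lambda>i. i = 0, 0)"
| "lgen (Gen T) = (\<lambda>_. False, 1)"
| "lgen (Inv T) = (\<lambda>_. False, - 1)"

abbreviation lamp :: "lamp_gen sletter list \<Rightarrow> lamps" where
  "lamp w \<equiv> lval (map lgen w)"

lemma lamp_cancel: "lmul (lgen x) (lgen (flip x)) = lone"
  by (cases x rule: lgen.cases) (auto simp: lmul_def lone_def)

lemma lamp_inv_word: "lmul (lamp (inv_word w)) (lamp w) = lone"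
proof (induction w)
  case Nil
  show ?case by (simp add: inv_word_def)
next
  case (Cons x w)
  have "lmul (lgen (flip x)) (lmul (lgen x) y) = y" for y
    using lamp_cancel[of "flip x"] by (simp flip: lmul_assoc)
  with Cons show ?case
    by (simp add: inv_word_def lval_append lmul_assoc)
qed

lemma lamp_gen_power: "lamp (gen_power T i) = (\<lambda>_. False, i)"
proof -
  have "lval (replicate n (\<lambda>_. False, d)) = (\<lambda>_. False, int n * d)" for n d
    by (induction n) (auto simp: lone_def lmul_def algebra_simps)
  then show ?thesis
    by (simp add: gen_power_def)
qed

lemma lamp_lamp_conj: "lamp (lamp_conj i) = (\<lambda>j. j = i, 0)"
  by (auto simp: lamp_conj_def lval_append lamp_gen_power lmul_def)

lemma lamp_commutator_conj: "lamp (commutator_word (lamp_conj i) (lamp_conj j)) = lone"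
proof -
  have "lamp (inv_word (lamp_conj i)) = (\<lambda>j. j = i, 0)" for i
    using lamp_inv_word[of "lamp_conj i"]
    by (cases "lamp (inv_word (lamp_conj i))")
      (auto simp: lamp_lamp_conj lmul_def lone_def fun_eq_iff)
  then show ?thesis
    by (auto simp: commutator_word_def lval_append lamp_lamp_conj lmul_def lone_def)
qed

text \<open>Cancelling pairs and relators have trivial configuration, so \<open>lamp\<close> is well
  defined on the presented group; this is one half of \<open>pc_eq_iff\<close>.\<close>

lemma pres_eq_imp_lamp_eq: "pres_eq lamp_relators u v \<Longrightarrow> lamp u = lamp v"
proof (induction rule: pres_eq.induct)
  case (cancel u x v)
  have "lmul (lgen x) (lmul (lgen (flip x)) y) = y" for y
    using lamp_cancel[of x] by (simp flip: lmul_assoc)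
  then show ?case by (simp add: lval_append)
next
  case (relator r u v)
  have "lamp [Gen A, Gen A] = lone"
    by (auto simp: lmul_def lone_def)
  then have "lamp r = lone"
    using relator lamp_commutator_conj by (auto simp: lamp_relators_def)
  then show ?case by (simp add: lval_append)
qed auto


subsection \<open>The lamplighter group as the group of lamp configurations\<close>

abbreviation pc :: "lamp_gen sletter list \<Rightarrow> lamp_gen sletter list set" where
  "pc \<equiv> pres_class lamp_relators"

interpretation L2: group L2
  by (rule group_L2)

lemma pc_closed [simp]: "pc w \<in> carrier L2"
  by (simp add: L2_def presented_group_def)

lemma carrier_L2: "carrier L2 = range pc"
  by (simp add: L2_def presented_group_def)

lemma pc_append: "pc (u @ v) = pc u \<otimes>\<^bsub>L2\<^esub> pc v"
  by (simp add: L2_def pres_class_mult)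

lemma pc_Nil: "pc [] = \<one>\<^bsub>L2\<^esub>"
  by (simp add: L2_def presented_group_def)

definition gen_class :: "lamp_gen sletter \<Rightarrow> lamp_gen sletter list set" where
  "gen_class x = pc [x]"

lemma gen_class_closed [simp]: "gen_class x \<in> carrier L2"
  by (simp add: gen_class_def)

lemma pc_Cons: "pc (x # w) = gen_class x \<otimes>\<^bsub>L2\<^esub> pc w"
  using pc_append[of "[x]" w] by (simp add: gen_class_def)

lemmas pc_simps = pc_Nil pc_Cons pc_append

lemma pc_eq_one_iff: "pc w = \<one>\<^bsub>L2\<^esub> \<longleftrightarrow> pres_eq lamp_relators w []"
  by (metis pc_Nil pres_class_eq_iff)

lemma pc_inv: "inv\<^bsub>L2\<^esub> pc w = pc (inv_word w)"
proof (rule L2.inv_equality)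
  show "pc (inv_word w) \<otimes>\<^bsub>L2\<^esub> pc w = \<one>\<^bsub>L2\<^esub>"
    by (metis pc_append pc_eq_one_iff inv_word_cancel)
qed simp_all

lemma gen_class_Inv: "gen_class (Inv x) = inv\<^bsub>L2\<^esub> gen_class (Gen x)"
  by (simp add: gen_class_def pc_inv inv_word_def)

lemma pc_gen_power: "pc (gen_power T i) = gen_class (Gen T) [^]\<^bsub>L2\<^esub> i"
proof -
  have *: "pc (replicate n x) = gen_class x [^]\<^bsub>L2\<^esub> n" for n :: nat and x
    by (induction n) (simp_all only: replicate_0 replicate_Suc pc_simps L2.nat_pow_0
        L2.nat_pow_Suc2[OF gen_class_closed])
  show ?thesis
  proof (cases "i < 0")
    case True
    then have "pc (gen_power T i) = gen_class (Inv T) [^]\<^bsub>L2\<^esub> nat (- i)"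
      by (simp add: gen_power_def *)
    also have "\<dots> = inv\<^bsub>L2\<^esub> (gen_class (Gen T) [^]\<^bsub>L2\<^esub> nat (- i))"
      by (simp only: gen_class_Inv L2.nat_pow_inv gen_class_closed)
    finally show ?thesis
      using True by (simp only: int_pow_def2 if_True)
  next
    case False
    then have "pc (gen_power T i) = gen_class (Gen T) [^]\<^bsub>L2\<^esub> nat i"
      by (simp add: gen_power_def *)
    then show ?thesis
      using False by (simp only: int_pow_def2 if_False)
  qed
qed

section \<open>Conjugates of the lamp generator as commuting involutions\<close>

lemma pc_lamp_conj:
  "pc (lamp_conj i) = gen_class (Gen T) [^]\<^bsub>L2\<^esub> i \<otimes>\<^bsub>L2\<^esub>
    (gen_class (Gen A) \<otimes>\<^bsub>L2\<^esub> inv\<^bsub>L2\<^esub> (gen_class (Gen T) [^]\<^bsub>L2\<^esub> i))"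
  by (simp add: lamp_conj_def pc_simps pc_gen_power L2.int_pow_neg)

lemma gen_class_A_square: "gen_class (Gen A) \<otimes>\<^bsub>L2\<^esub> gen_class (Gen A) = \<one>\<^bsub>L2\<^esub>"
proof -
  have "pres_eq lamp_relators [Gen A, Gen A] []"
    using pres_eq.relator[of "[Gen A, Gen A]" lamp_relators "[]" "[]"]
    by (simp add: lamp_relators_def)
  then have "pc [Gen A, Gen A] = \<one>\<^bsub>L2\<^esub>"
    by (simp only: pc_eq_one_iff)
  then show ?thesis
    by (simp add: pc_simps)
qed

lemma pc_lamp_conj_square: "pc (lamp_conj i) \<otimes>\<^bsub>L2\<^esub> pc (lamp_conj i) = \<one>\<^bsub>L2\<^esub>"
proof -
  let ?t = "gen_class (Gen T) [^]\<^bsub>L2\<^esub> i" and ?a = "gen_class (Gen A)"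
  have [simp]: "?t \<in> carrier L2"
    by simp
  have cancel: "inv\<^bsub>L2\<^esub> ?t \<otimes>\<^bsub>L2\<^esub> (?t \<otimes>\<^bsub>L2\<^esub> x) = x" "?a \<otimes>\<^bsub>L2\<^esub> (?a \<otimes>\<^bsub>L2\<^esub> x) = x"
    if "x \<in> carrier L2" for x
    using that by (simp_all add: gen_class_A_square flip: L2.m_assoc)
  show ?thesis
    by (simp add: pc_lamp_conj L2.m_assoc cancel)
qed

lemma pc_lamp_conj_commute:
  "pc (lamp_conj i) \<otimes>\<^bsub>L2\<^esub> pc (lamp_conj j) = pc (lamp_conj j) \<otimes>\<^bsub>L2\<^esub> pc (lamp_conj i)"
proof -
  let ?u = "pc (lamp_conj i)" and ?v = "pc (lamp_conj j)"
  have inv: "inv\<^bsub>L2\<^esub> pc (lamp_conj k) = pc (lamp_conj k)" for k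
    by (simp add: L2.inv_equality pc_lamp_conj_square)
  have "pres_eq lamp_relators (commutator_word (lamp_conj i) (lamp_conj j)) []"
    using pres_eq.relator[of "commutator_word (lamp_conj i) (lamp_conj j)" lamp_relators "[]" "[]"]
    unfolding lamp_relators_def by fastforce
  then have "pc (commutator_word (lamp_conj i) (lamp_conj j)) = \<one>\<^bsub>L2\<^esub>"
    by (simp only: pc_eq_one_iff)
  \<comment> \<open>Both factors are their own inverses, so the commutator is the square of their
    product; inverting the product then swaps its factors.\<close>
  then have "(?u \<otimes>\<^bsub>L2\<^esub> ?v) \<otimes>\<^bsub>L2\<^esub> (?u \<otimes>\<^bsub>L2\<^esub> ?v) = \<one>\<^bsub>L2\<^esub>"
    by (simp add: commutator_word_def pc_append inv L2.m_assoc flip: pc_inv)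
  then have "inv\<^bsub>L2\<^esub> (?u \<otimes>\<^bsub>L2\<^esub> ?v) = ?u \<otimes>\<^bsub>L2\<^esub> ?v"
    by (simp add: L2.inv_equality)
  then show ?thesis
    by (simp add: L2.inv_mult_group inv)
qed

lemma pc_lamps_commute:
  "pc (concat (map lamp_conj xs)) \<otimes>\<^bsub>L2\<^esub> pc (lamp_conj i)
    = pc (lamp_conj i) \<otimes>\<^bsub>L2\<^esub> pc (concat (map lamp_conj xs))"
proof (induction xs)
  case Nil
  show ?case by (simp add: pc_Nil)
next
  case (Cons j xs)
  let ?c = "pc (concat (map lamp_conj xs))"
  have "pc (lamp_conj j) \<otimes>\<^bsub>L2\<^esub> ?c \<otimes>\<^bsub>L2\<^esub> pc (lamp_conj i)
      = (pc (lamp_conj j) \<otimes>\<^bsub>L2\<^esub> pc (lamp_conj i)) \<otimes>\<^bsub>L2\<^esub> ?c"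
    by (simp add: Cons L2.m_assoc)
  also have "\<dots> = pc (lamp_conj i) \<otimes>\<^bsub>L2\<^esub> (pc (lamp_conj j) \<otimes>\<^bsub>L2\<^esub> ?c)"
    by (simp only: pc_lamp_conj_commute[of j i] L2.m_assoc pc_closed)
  finally show ?case
    by (simp add: pc_append)
qed

text \<open>Induction on the length: an even count gives the first index a second occurrence, whose
  factor commutes to the front, where the two cancel.\<close>

lemma pc_lamps_trivial:
  "(\<And>i. even (count_list xs i)) \<Longrightarrow> pc (concat (map lamp_conj xs)) = \<one>\<^bsub>L2\<^esub>"
proof (induction xs rule: length_induct)
  case (1 xs)
  show ?case
  proof (cases xs)
    case Nil
    then show ?thesis by (simp add: pc_Nil)
  next
    case (Cons i ys)
    have "odd (count_list ys i)"
      using "1.prems"[of i] by (simp add: Cons)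
    then have "i \<in> set ys"
      by (metis count_notin even_zero)
    then obtain us vs where ys: "ys = us @ i # vs"
      by (auto simp: in_set_conv_decomp)
    let ?u = "pc (concat (map lamp_conj us))" and ?v = "pc (concat (map lamp_conj vs))"
      and ?c = "pc (lamp_conj i)"
    have "even (count_list (us @ vs) j)" for j
      using "1.prems"[of j] by (auto simp: Cons ys split: if_splits)
    moreover have "length (us @ vs) < length xs"
      by (simp add: Cons ys)
    ultimately have "pc (concat (map lamp_conj (us @ vs))) = \<one>\<^bsub>L2\<^esub>"
      using "1.IH" by blast
    then have uv: "?u \<otimes>\<^bsub>L2\<^esub> ?v = \<one>\<^bsub>L2\<^esub>"
      by (simp add: pc_append)
    have "pc (concat (map lamp_conj xs)) = ?c \<otimes>\<^bsub>L2\<^esub> (?u \<otimes>\<^bsub>L2\<^esub> ?c \<otimes>\<^bsub>L2\<^esub> ?v)"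
      by (simp add: Cons ys pc_append L2.m_assoc)
    also have "\<dots> = (?c \<otimes>\<^bsub>L2\<^esub> ?c) \<otimes>\<^bsub>L2\<^esub> (?u \<otimes>\<^bsub>L2\<^esub> ?v)"
      by (simp only: pc_lamps_commute L2.m_assoc pc_closed L2.m_closed)
    finally show ?thesis
      by (simp add: pc_lamp_conj_square uv)
  qed
qed

text \<open>The list \<open>xs\<close> may have repetitions; only parities of multiplicities matter, which avoids
  maintaining a sorted or reduced form.\<close>

lemma pc_normal_form:
  "\<exists>xs p. pc w = pc (concat (map lamp_conj xs) @ gen_power T p)"
proof (induction w rule: rev_induct)
  case Nil
  have "concat (map lamp_conj []) @ gen_power T 0 = []"
    by (simp add: gen_power_def)
  then show ?case by metis
next
  case (snoc x w)
  then obtain xs p where w: "pc w = pc (concat (map lamp_conj xs) @ gen_power T p)"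
    by blast
  let ?c = "pc (concat (map lamp_conj xs))" and ?t = "gen_class (Gen T)" and ?a = "gen_class (Gen A)"
  have wx: "pc (w @ [x]) = ?c \<otimes>\<^bsub>L2\<^esub> (?t [^]\<^bsub>L2\<^esub> p \<otimes>\<^bsub>L2\<^esub> gen_class x)"
    by (simp add: w L2.m_assoc pc_gen_power pc_simps)
  have move: "\<exists>xs p. pc (w @ [x]) = pc (concat (map lamp_conj xs) @ gen_power T p)"
    if "gen_class x = ?t [^]\<^bsub>L2\<^esub> d" for d :: int
  proof -
    have "pc (w @ [x]) = pc (concat (map lamp_conj xs) @ gen_power T (p + d))"
      unfolding wx by (simp add: that pc_gen_power L2.int_pow_mult pc_append)
    then show ?thesis by blast
  qed
  have toggle: "\<exists>xs p. pc (w @ [x]) = pc (concat (map lamp_conj xs) @ gen_power T p)"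
    if "gen_class x = ?a"
  proof -
    \<comment> \<open>This is \<open>t^p a = (t^p a t^-p) t^p\<close>: a toggle at position
      \<open>p\<close> adds the index \<open>p\<close> to the list and keeps the exponent.\<close>
    have "pc (concat (map lamp_conj (xs @ [p])) @ gen_power T p) = pc (w @ [x])"
      unfolding wx by (simp add: that pc_lamp_conj pc_gen_power L2.m_assoc pc_append)
    then show ?thesis by metis
  qed
  have "inv\<^bsub>L2\<^esub> ?a = ?a"
    by (simp add: L2.inv_equality gen_class_A_square)
  then show ?case
    using toggle move[of 1] move[of "- 1"]
    by (cases x rule: lgen.cases) (simp_all add: gen_class_Inv L2.int_pow_1 L2.int_pow_neg)
qed

lemma lamp_concat_lamp_conj:
  "lamp (concat (map lamp_conj xs)) = (\<lambda>i. odd (count_list xs i), 0)"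
  by (induction xs) (auto simp: lone_def lval_append lamp_lamp_conj lmul_def)

text \<open>The model is faithful: if \<open>u\<close> and \<open>v\<close> have the same
  configuration, the normal form of \<open>v^-1 u\<close> has exponent 0 and only even
  multiplicities, so it is trivial in \<open>L2\<close>.\<close>

lemma pc_eq_iff: "pc u = pc v \<longleftrightarrow> lamp u = lamp v"
proof
  assume "pc u = pc v"
  then show "lamp u = lamp v"
    by (simp add: pres_class_eq_iff pres_eq_imp_lamp_eq)
next
  assume uv: "lamp u = lamp v"
  let ?w = "inv_word v @ u"
  obtain xs p where w: "pc ?w = pc (concat (map lamp_conj xs) @ gen_power T p)"
    using pc_normal_form by blast
  then have "lamp ?w = lamp (concat (map lamp_conj xs) @ gen_power T p)"
    by (simp only: pres_class_eq_iff pres_eq_imp_lamp_eq)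
  moreover have "lamp ?w = lone"
    by (simp add: lval_append uv lamp_inv_word)
  ultimately have "(\<lambda>i. odd (count_list xs i), p) = lone"
    by (simp add: lval_append lamp_concat_lamp_conj lamp_gen_power lmul_def)
  then have "p = 0" and "\<And>i. even (count_list xs i)"
    by (auto simp: lone_def fun_eq_iff)
  then have "pc ?w = \<one>\<^bsub>L2\<^esub>"
    using w by (simp add: pc_lamps_trivial gen_power_def)
  then have "inv\<^bsub>L2\<^esub> pc v \<otimes>\<^bsub>L2\<^esub> pc u = \<one>\<^bsub>L2\<^esub>"
    by (simp add: pc_inv pc_append)
  then have "inv\<^bsub>L2\<^esub> (inv\<^bsub>L2\<^esub> pc v) = pc u"
    by (metis L2.inv_closed L2.inv_equality L2.inv_comm pc_closed)
  then show "pc u = pc v"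
    by simp
qed

section \<open>Embedding of the group into configurations and images of the letters\<close>

definition config :: "lamp_gen sletter list set \<Rightarrow> lamps" where
  "config C = lamp (SOME u. C = pc u)"

lemma config_pc [simp]: "config (pc u) = lamp u"
proof -
  have "pc u = pc (SOME v. pc u = pc v)"
    by (rule someI[of "\<lambda>v. pc u = pc v"]) (rule HOL.refl)
  then show ?thesis
    by (simp add: config_def pc_eq_iff)
qed

lemma config_inj: "x \<in> carrier L2 \<Longrightarrow> y \<in> carrier L2 \<Longrightarrow> config x = config y \<Longrightarrow> x = y"
  unfolding carrier_L2 using config_pc pc_eq_iff by force

lemma config_mult:
  "x \<in> carrier L2 \<Longrightarrow> y \<in> carrier L2 \<Longrightarrow> config (x \<otimes>\<^bsub>L2\<^esub> y) = lmul (config x) (config y)"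
  by (auto simp: carrier_L2 lval_append simp flip: pc_append)

text \<open>Images of \<open>t\<close>, \<open>ta\<close> and their inverses. The letter
  \<open>ta\<close> moves right and then toggles; its inverse toggles and then moves left. Either
  way the lamp belongs to the edge crossed.\<close>

definition letters :: "lamps set" where
  "letters = {(\<lambda>_. False, 1), (\<lambda>i. i = 1, 1), (\<lambda>_. False, - 1), (\<lambda>i. i = 0, - 1)}"

abbreviation \<Sigma> :: "lamp_gen sletter list set set" where
  "\<Sigma> \<equiv> alphabet L2 automata_gens"

lemma letter_step: "x \<in> letters \<Longrightarrow> snd x = 1 \<or> snd x = - 1"
  by (auto simp: letters_def)

lemma letter_lit: "x \<in> letters \<Longrightarrow> fst x i \<Longrightarrow> snd x = 1 \<and> i = 1 \<or> snd x = - 1 \<and> i = 0"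
  by (auto simp: letters_def)

lemma config_alphabet: "config ` \<Sigma> = letters"
proof -
  have "\<Sigma> = {pc [Gen T], pc [Gen T, Gen A], pc [Inv T], pc [Inv A, Inv T]}"
    by (auto simp: alphabet_def automata_gens_def L2_t_def L2_a_def pc_inv inv_word_def simp flip: pc_append)
  then show ?thesis
    by (auto simp: letters_def lmul_def lone_def)
qed

lemma alphabet_carrier: "\<Sigma> \<subseteq> carrier L2"
  by (auto simp: alphabet_def automata_gens_def L2_t_def L2_a_def)

lemma word_value_closed: "w \<in> lists \<Sigma> \<Longrightarrow> word_value L2 w \<in> carrier L2"
  using alphabet_carrier by (induction w) (auto simp: word_value_def)

lemma config_word_value: "w \<in> lists \<Sigma> \<Longrightarrow> config (word_value L2 w) = lval (map config w)"
proof (induction w)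
  case Nil
  show ?case by (simp add: word_value_def flip: pc_Nil)
next
  case (Cons x w)
  then have "config (x \<otimes>\<^bsub>L2\<^esub> word_value L2 w) = lmul (config x) (config (word_value L2 w))"
    using alphabet_carrier word_value_closed by (intro config_mult) auto
  with Cons show ?case by (simp add: word_value_def)
qed

lemma letters_word_lift:
  assumes "v \<in> lists letters"
  obtains w where "w \<in> lists \<Sigma>" "map config w = v"
  using assms unfolding config_alphabet[symmetric] lists_image by blast

text \<open>Turns geodesicity into a comparison of configuration words: \<open>v\<close> lifts to a
  word over the generators, and injectivity of \<open>config\<close> makes that word represent the
  same element.\<close>

lemma geodesic_length_le:
  assumes "geodesic L2 automata_gens w" and "v \<in> lists letters" and "lval v = lval (map config w)"
  shows "length w \<le> length v"
proof -
  obtain u where u: "u \<in> lists \<Sigma>" "map config u = v"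
    using letters_word_lift[OF assms(2)] .
  have w: "w \<in> lists \<Sigma>"
    using assms(1) by (simp add: geodesic_def)
  have "word_value L2 u = word_value L2 w"
    using u w assms(3) by (intro config_inj word_value_closed) (simp_all add: config_word_value)
  then have "word_length L2 automata_gens (word_value L2 w) \<le> length u"
    unfolding word_length_def using u(1) by (intro Least_le) auto
  then show ?thesis
    using assms(1) u(2) by (auto simp: geodesic_def)
qed


subsection \<open>Paths of the lamplighter\<close>

lemma abs_position_le: "v \<in> lists letters \<Longrightarrow> \<bar>snd (lval v)\<bar> \<le> int (length v)"
  by (induction v) (auto simp: letters_def lone_def)

text \<open>Only a letter crossing an edge toggles its lamp, so a lit lamp forces visits to both
  ends of its edge. The induction removes the first letter and shifts coordinates by its
  step.\<close>

lemma lit_imp_visited: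
  assumes "w \<in> lists letters" and "fst (lval w) e" and "d = e \<or> d = e - 1"
  shows "\<exists>u v. w = u @ v \<and> snd (lval u) = d"
  using assms
proof (induction w arbitrary: e d rule: list.induct)
  case Nil
  then show ?case by (simp add: lone_def)
next
  case (Cons x w)
  show ?case
  proof (cases "fst x e")
    case True
    then have "d = 0 \<or> d = snd x"
      using letter_lit[of x e] Cons.prems(1,3) by auto
    then show ?thesis
    proof
      assume "d = 0"
      then have "x # w = [] @ (x # w) \<and> snd (lval []) = d"
        by (simp add: lone_def)
      then show ?thesis by blast
    next
      assume "d = snd x"
      then have "x # w = [x] @ w \<and> snd (lval [x]) = d"
        by simp
      then show ?thesis by blast
    qed
  next
    case False
    then have "fst (lval w) (e - snd x)"
      using Cons.prems by (simp add: fst_lmul)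
    then obtain u v where "w = u @ v" "snd (lval u) = d - snd x"
      using Cons.IH[of "e - snd x" "d - snd x"] Cons.prems by auto
    then have "x # w = (x # u) @ v \<and> snd (lval (x # u)) = d"
      by simp
    then show ?thesis by blast
  qed
qed

text \<open>A single step to the right would make the displacement fall short of the length.\<close>

lemma straight_left:
  "v \<in> lists letters \<Longrightarrow> int (length v) \<le> - snd (lval v) \<Longrightarrow> \<forall>x\<in>set v. snd x = - 1"
proof (induction v)
  case (Cons x v)
  have v: "v \<in> lists letters" and x: "x \<in> letters"
    using Cons.prems(1) by auto
  have "snd x = - 1" "int (length v) \<le> - snd (lval v)"
    using abs_position_le[OF v] letter_step[OF x] Cons.prems(2) by auto
  with Cons.IH v show ?case by simp
qed simp

lemma lval_left:
  "v \<in> lists letters \<Longrightarrow> \<forall>x\<in>set v. snd x = - 1 \<Longrightarrow>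
    snd (lval v) = - int (length v) \<and> (\<forall>i. fst (lval v) i \<longrightarrow> - int (length v) < i \<and> i \<le> 0)"
proof (induction v)
  case Nil
  show ?case by (simp add: lone_def)
next
  case (Cons x v)
  then have IH: "snd (lval v) = - int (length v)"
      "\<And>i. fst (lval v) i \<Longrightarrow> - int (length v) < i \<and> i \<le> 0"
    by auto
  have x: "snd x = - 1" "\<And>i. fst x i \<Longrightarrow> i = 0"
    using Cons.prems letter_lit[of x] by force+
  have "- int (length (x # v)) < i \<and> i \<le> 0" if "fst (lval (x # v)) i" for i
    using that IH(2)[of "i + 1"] x(1) x(2)[of i] by (auto simp: fst_lmul)
  with IH(1) x show ?case by auto
qed

section \<open>Words realising prescribed lamps\<close>

lemma lval_right: "lval (replicate k (\<lambda>_. False, 1)) = (\<lambda>_. False, int k)"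
  by (induction k) (auto simp: lone_def lmul_def)

lemma lval_left_lit: "lval (replicate k (\<lambda>i. i = 0, - 1)) = (\<lambda>i. - int k < i \<and> i \<le> 0, - int k)"
  by (induction k) (auto simp: lone_def lmul_def fun_eq_iff)

text \<open>Each edge is crossed once on a straight walk left, and the choice of letter there
  decides its lamp independently of the others.\<close>

lemma left_word_exists:
  assumes "\<And>i. f i \<Longrightarrow> - int k < i \<and> i \<le> 0"
  shows "\<exists>w \<in> lists letters. length w = k \<and> lval w = (f, - int k)"
  using assms
proof (induction k arbitrary: f)
  case 0
  have "f i = False" for i
    using 0[of i] by auto
  then show ?case
    by (intro bexI[of _ "[]"]) (simp_all add: lone_def fun_eq_iff)
next
  case (Suc k)
  \<comment> \<open>The pattern seen from position -1 after the first step; \<open>j \<le> 0\<close>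
    drops lamp 0, which the first letter sets.\<close>
  define g where "g j \<longleftrightarrow> j \<le> 0 \<and> f (j - 1)" for j
  have "- int k < i \<and> i \<le> 0" if "g i" for i
    using that Suc.prems[of "i - 1"] by (auto simp: g_def)
  then obtain w where w: "w \<in> lists letters" "length w = k" "lval w = (g, - int k)"
    using Suc.IH by blast
  let ?x = "(\<lambda>i. f 0 \<and> i = 0, - 1) :: lamps"
  have x: "?x \<in> letters"
    by (cases "f 0") (auto simp: letters_def)
  have "f i \<longleftrightarrow> (f 0 \<and> i = 0) \<noteq> g (i + 1)" for i
    using Suc.prems[of i] by (cases "i = 0") (auto simp: g_def)
  then have "f = (\<lambda>i. (f 0 \<and> i = 0) \<noteq> g (i + 1))"
    by (intro ext)
  then have "lval (?x # w) = (f, - int (Suc k))"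
    by (simp add: w(3) lmul_def)
  then show ?case
    using w x by (intro bexI[of _ "?x # w"]) auto
qed

text \<open>Walk right to \<open>b\<close> without lighting, set all lamps on the way left to
  \<open>-a\<close>, then walk right to \<open>p\<close>: \<open>b + (a + b) + (a + p)\<close>
  steps.\<close>

lemma right_left_right_word:
  assumes supp: "\<And>i. f i \<Longrightarrow> - int a < i \<and> i \<le> int b" and p: "- int a \<le> p"
  shows "\<exists>w \<in> lists letters. int (length w) = 2 * int a + 2 * int b + p \<and> lval w = (f, p)"
proof -
  have "- int (a + b) < i \<and> i \<le> 0" if "f (i + int b)" for i
    using supp[OF that] by auto
  then obtain v where v: "v \<in> lists letters" "length v = a + b"
      "lval v = (\<lambda>i. f (i + int b), - int (a + b))"
    using left_word_exists[of "\<lambda>i. f (i + int b)" "a + b"] by blast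
  let ?r = "\<lambda>k. replicate k (\<lambda>_::int. False, 1::int)"
  let ?w = "?r b @ v @ ?r (nat (int a + p))"
  have "set (?r k) \<subseteq> letters" for k
    by (auto simp: letters_def)
  then have "?w \<in> lists letters"
    using v(1) by (fastforce simp: in_lists_conv_set)
  moreover have "int (length ?w) = 2 * int a + 2 * int b + p"
    using p by (simp add: v(2))
  moreover have "lval ?w = (f, p)"
    using p by (simp add: lval_append lval_right v(3) lmul_def)
  ultimately show ?thesis by blast
qed

text \<open>A shortest path from 0 to 1 that crosses all of \<open>[-m, n]\<close> must visit \<open>-m\<close> before \<open>n\<close>,
  since the other order costs two more steps.\<close>

lemma short_path_starts_left:
  assumes w: "w \<in> lists letters" and pos: "snd (lval w) = 1"
    and lit: "fst (lval w) (1 - int m)" "fst (lval w) (int n)"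
    and len: "length w + 1 \<le> 2 * m + 2 * n"
  shows "\<exists>u v. w = u @ v \<and> length u = m \<and> (\<forall>x\<in>set u. snd x = - 1)"
    and "length w + 1 = 2 * m + 2 * n"
proof -
  obtain u v where uv: "w = u @ v" "snd (lval u) = - int m"
    using lit_imp_visited[OF w lit(1), of "- int m"] by auto
  obtain u' v' where uv': "w = u' @ v'" "snd (lval u') = int n"
    using lit_imp_visited[OF w lit(2), of "int n"] by auto
  have "u @ v = u' @ v'"
    using uv uv' by simp
  then consider s where "u = u' @ s" "v' = s @ v" | s where "u' = u @ s" "v = s @ v'"
    by (auto simp: append_eq_append_conv2)
  then have *: "length u = m \<and> length w + 1 = 2 * m + 2 * n"
  proof cases
    \<comment> \<open>Here \<open>n\<close> is visited before \<open>-m\<close>: at least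
      \<open>n + (n + m) + (m + 1)\<close> steps, which exceeds the bound.\<close>
    case 1
    have "u' \<in> lists letters" "s \<in> lists letters" "v \<in> lists letters"
      using w uv 1 by auto
    then show ?thesis
      using abs_position_le[of u'] abs_position_le[of s] abs_position_le[of v]
        uv uv' 1 len pos by (auto simp: lval_append)
  next
    \<comment> \<open>Here \<open>-m\<close> is visited before \<open>n\<close>: the lower bound
      \<open>m + (m + n) + (n - 1)\<close> is exactly the allowed length, so all three pieces are
      tight.\<close>
    case 2
    have "u \<in> lists letters" "s \<in> lists letters" "v' \<in> lists letters"
      using w uv 2 by auto
    then show ?thesis
      using abs_position_le[of u] abs_position_le[of s] abs_position_le[of v']
        uv uv' 2 len pos by (auto simp: lval_append)
  qed
  then show "length w + 1 = 2 * m + 2 * n"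
    by simp
  have "\<forall>x\<in>set u. snd x = - 1"
    using straight_left[of u] w uv * by auto
  with * uv show "\<exists>u v. w = u @ v \<and> length u = m \<and> (\<forall>x\<in>set u. snd x = - 1)"
    by blast
qed

text \<open>With \<open>k\<close> the length of \<open>y\<close>, two extra copies shift the rest
  left by \<open>2k\<close>: the pumped word has \<open>2m + 2n + 2k - 1\<close> letters and ends at
  \<open>1 - 2k\<close>. Visiting the right end first takes \<open>2m + 2n - 2k + 1\<close>, which
  is smaller since \<open>k \<ge> 1\<close>. One extra copy would only give a tie when
  \<open>k = 1\<close>.\<close>

lemma pumped_word_shortcut:
  assumes w: "x @ y @ z \<in> lists letters"
    and left: "\<forall>c\<in>set (x @ y). snd c = - 1" and y: "y \<noteq> []"
    and xy: "length (x @ y) \<le> m" and n: "2 * m \<le> n"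
    and pos: "snd (lval (x @ y @ z)) = 1"
    and supp: "\<And>i. fst (lval (x @ y @ z)) i \<Longrightarrow> - int m < i \<and> i \<le> int n"
    and len: "length (x @ y @ z) + 1 = 2 * m + 2 * n"
  shows "\<exists>v \<in> lists letters. lval v = lval (x @ y @ y @ y @ z) \<and> length v < length (x @ y @ y @ y @ z)"
proof -
  define k l where "k = length y" and "l = length (x @ y)"
  have kl: "1 \<le> k" "k \<le> l" "l \<le> m"
    using y xy by (auto simp: k_def l_def Suc_le_eq)
  have letters: "x @ y \<in> lists letters" "x @ y @ y @ y \<in> lists letters"
    using w by auto
  note xy_left = lval_left[OF letters(1) left]
  have left3: "\<forall>c\<in>set (x @ y @ y @ y). snd c = - 1"
    using left by auto
  note xyyy = lval_left[OF letters(2) left3]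
  have z: "lval (x @ y @ z) = lmul (lval (x @ y)) (lval z)"
    "lval (x @ y @ y @ y @ z) = lmul (lval (x @ y @ y @ y)) (lval z)"
    by (simp_all add: lval_append lmul_assoc)
  have pz: "snd (lval z) = 1 + int l"
    using pos xy_left by (simp add: z l_def)
  \<comment> \<open>Lamps combine by exclusive or, so a lamp lit by \<open>z\<close> is lit in the
    whole word or in the prefix \<open>xy\<close>; both bounds are then shifted by
    \<open>l\<close>.\<close>
  have zsupp: "int l - int m < j \<and> j \<le> int n + int l" if "fst (lval z) j" for j
  proof -
    have "fst (lval (x @ y @ z)) (j - int l) \<or> fst (lval (x @ y)) (j - int l)"
      using that xy_left by (auto simp: z fst_lmul l_def)
    then show ?thesis
      using supp[of "j - int l"] xy_left kl by (auto simp: l_def)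
  qed
  \<comment> \<open>The shift brings the right bound to \<open>n - 2k\<close>, while the prefix
    lights no lamp beyond 0; \<open>2m \<le> n\<close> and \<open>k \<le> m\<close> keep
    \<open>n - 2k\<close> nonnegative.\<close>
  have supp': "- int (m + 2 * k) < i \<and> i \<le> int (n - 2 * k)"
    if "fst (lval (x @ y @ y @ y @ z)) i" for i
  proof -
    have "fst (lval (x @ y @ y @ y)) i \<or> fst (lval z) (i + int (l + 2 * k))"
      using that xyyy by (auto simp: z fst_lmul l_def k_def algebra_simps)
    then show ?thesis
      using xyyy zsupp[of "i + int (l + 2 * k)"] kl n by (fastforce simp: l_def k_def)
  qed
  have pos': "snd (lval (x @ y @ y @ y @ z)) = 1 - 2 * int k"
    using xyyy by (simp add: z pz l_def k_def)
  obtain v where "v \<in> lists letters" "lval v = lval (x @ y @ y @ y @ z)"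
    "int (length v) = 2 * int (m + 2 * k) + 2 * int (n - 2 * k) + (1 - 2 * int k)"
    using right_left_right_word[of "fst (lval (x @ y @ y @ y @ z))" "m + 2 * k" "n - 2 * k" "1 - 2 * int k"]
      supp' pos' by (auto simp del: of_nat_add of_nat_mult simp: prod_eq_iff)
  moreover have "length (x @ y @ y @ y @ z) + 1 = 2 * m + 2 * n + 2 * k"
    using len by (simp add: k_def)
  ultimately show ?thesis
    using kl n by (intro bexI[of _ v]) auto
qed


subsection \<open>Pumping\<close>

lemma run_append: "run M p (u @ v) q \<longleftrightarrow> (\<exists>r. run M p u r \<and> run M r v q)"
  by (induction u arbitrary: p) auto

lemma run_states: "is_fsa X M \<Longrightarrow> p \<in> states M \<Longrightarrow> run M p w q \<Longrightarrow> q \<in> states M"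
  by (induction w arbitrary: p) (auto simp: is_fsa_def)

text \<open>\<open>s i\<close> is the state after \<open>i\<close> letters. Giving the runs on all
  subwords lets a repeated state yield a loop at once.\<close>

lemma run_trace:
  "run M p w q \<Longrightarrow> \<exists>s. s 0 = p \<and> s (length w) = q
    \<and> (\<forall>i j. i \<le> j \<and> j \<le> length w \<longrightarrow> run M (s i) (take (j - i) (drop i w)) (s j))"
proof (induction w arbitrary: p)
  case Nil
  then show ?case by (intro exI[of _ "\<lambda>_. p"]) auto
next
  case (Cons x w)
  then obtain r where r: "(p, x, r) \<in> edges M" "run M r w q"
    by auto
  from Cons.IH[OF r(2)] obtain s where s: "s 0 = r" "s (length w) = q"
    "\<And>i j. i \<le> j \<Longrightarrow> j \<le> length w \<Longrightarrow> run M (s i) (take (j - i) (drop i w)) (s j)"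
    by blast
  let ?s = "\<lambda>i. case i of 0 \<Rightarrow> p | Suc i \<Rightarrow> s i"
  have "run M (?s i) (take (j - i) (drop i (x # w))) (?s j)"
    if "i \<le> j" "j \<le> length (x # w)" for i j
    using that r(1) s(1) s(3)[of 0 "j - 1"] s(3)[of "i - 1" "j - 1"]
    by (cases i; cases j) auto
  then show ?case
    using s(2) by (intro exI[of _ ?s]) auto
qed

text \<open>The loop is found inside \<open>u\<close>, so that later only the leftward start of a
  geodesic is pumped; \<open>y\<close> is tripled to suit
  \<open>pumped_word_shortcut\<close>.\<close>

lemma pumping:
  assumes M: "is_fsa X M" and p: "p \<in> states M" and run: "run M p (u @ v) q"
    and len: "card (states M) \<le> length u"
  shows "\<exists>x y z. u = x @ y @ z \<and> y \<noteq> [] \<and> run M p (x @ y @ y @ y @ z @ v) q"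
proof -
  obtain r where r: "run M p u r" "run M r v q"
    using run by (auto simp: run_append)
  from run_trace[OF r(1)] obtain s where s: "s 0 = p" "s (length u) = r"
    "\<And>i j. i \<le> j \<Longrightarrow> j \<le> length u \<Longrightarrow> run M (s i) (take (j - i) (drop i u)) (s j)"
    by blast
  have "s i \<in> states M" if "i \<le> length u" for i
    using run_states[OF M p] s(3)[of 0 i] s(1) that by auto
  then have "s ` {..length u} \<subseteq> states M"
    by auto
  moreover have "finite (states M)"
    using M by (simp add: is_fsa_def)
  \<comment> \<open>There are \<open>length u + 1\<close> indices but at most
    \<open>length u\<close> states.\<close>
  ultimately have "card (s ` {..length u}) < card {..length u}"
    using card_mono[of "states M" "s ` {..length u}"] len by simp
  then have "\<not> inj_on s {..length u}"
    by (rule pigeonhole)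
  then obtain i j where ij: "i < j" "j \<le> length u" "s i = s j"
    by (auto simp: inj_on_def) (metis linorder_neqE_nat)
  let ?x = "take i u" and ?y = "take (j - i) (drop i u)" and ?z = "drop j u"
  have "run M p ?x (s i)"
    using s(3)[of 0 i] s(1) ij by simp
  moreover have "run M (s i) ?y (s i)"
    using s(3)[of i j] ij by simp
  moreover have "run M (s i) ?z r"
    using s(3)[of j "length u"] s(2) ij by simp
  ultimately have "run M p (?x @ ?y @ ?y @ ?y @ ?z @ v) q"
    using r(2) unfolding run_append by blast
  moreover have "u = ?x @ ?y @ ?z"
    using ij by (metis append_take_drop_id drop_drop le_add_diff_inverse2 less_imp_le)
  moreover have "?y \<noteq> []"
    using ij by simp
  ultimately show ?thesis by blast
qed

section \<open>Pumping a geodesic of a pattern lit at both ends\<close>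

theorem theorem22:
  "\<not> (\<exists>L. language_of_geodesics L2 automata_gens L
        \<and> regular_language (alphabet L2 automata_gens) L)"
proof
  assume "\<exists>L. language_of_geodesics L2 automata_gens L \<and> regular_language \<Sigma> L"
  then obtain L M where LG: "language_of_geodesics L2 automata_gens L"
    and M: "is_fsa \<Sigma> M" and L: "accepted_language M = L"
    by (auto simp: regular_language_def)
  have geo: "geodesic L2 automata_gens w" if "w \<in> L" for w
    using LG that by (simp add: language_of_geodesics_def)
  have onto: "\<exists>w\<in>L. word_value L2 w = g" if "g \<in> carrier L2" for g
    using LG that by (simp add: language_of_geodesics_def)
  \<comment> \<open>Reading \<open>m\<close> letters forces a repeated state, and
    \<open>n = 2m\<close> lets the right end shift left by up to \<open>2m\<close>.\<close>
  define m where "m = card (states M)"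
  define n where "n = 2 * m"
  have st: "start M \<in> states M" "finite (states M)"
    using M by (auto simp: is_fsa_def)
  \<comment> \<open>Positivity of \<open>m\<close> ensures that the extreme lamps
    \<open>1 - m\<close> and \<open>n\<close> of the pattern below are lit.\<close>
  then have m: "1 \<le> m"
    by (auto simp: m_def Suc_le_eq card_gt_0_iff)
  let ?l = "\<lambda>k. replicate k (\<lambda>i::int. i = 0, - 1::int)"
  \<comment> \<open>Light the edges from 0 to \<open>-m\<close>, walk to \<open>n\<close> without
    lighting, light the edges back to 1: \<open>2m + 2n - 1\<close> letters, the bound of
    \<open>short_path_starts_left\<close>.\<close>
  define g where "g = ?l m @ replicate (m + n) (\<lambda>_. False, 1) @ ?l (n - 1)"
  have g_letters: "g \<in> lists letters"
    by (auto simp: g_def letters_def)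
  have g_len: "length g + 1 = 2 * m + 2 * n"
    using m by (simp add: g_def n_def)
  have g_val: "lval g = (\<lambda>i. - int m < i \<and> i \<le> 0 \<or> 1 < i \<and> i \<le> int n, 1)"
    using m by (auto simp: g_def lval_append lval_right lval_left_lit lmul_def fun_eq_iff n_def)
  obtain g' where g': "g' \<in> lists \<Sigma>" "map config g' = g"
    using letters_word_lift[OF g_letters] .
  obtain w where w: "w \<in> L" "word_value L2 w = word_value L2 g'"
    using onto word_value_closed[OF g'(1)] by blast
  have w\<Sigma>: "w \<in> lists \<Sigma>"
    using geo[OF w(1)] by (simp add: geodesic_def)
  have val: "lval (map config w) = lval g"
    using config_word_value[OF w\<Sigma>] config_word_value[OF g'(1)] w(2) g'(2) by simp
  have w_letters: "map config w \<in> lists letters"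
    using w\<Sigma> by (auto simp flip: config_alphabet)
  \<comment> \<open>The accepted geodesic \<open>w\<close> is no longer than \<open>g\<close>, which
    forces its first \<open>m\<close> letters to go left.\<close>
  have "length (map config w) + 1 \<le> 2 * m + 2 * n"
    using geodesic_length_le[OF geo[OF w(1)] g_letters] val g_len by simp
  note short = short_path_starts_left[OF w_letters _ _ _ this]
  have lit: "fst (lval (map config w)) (1 - int m)" "fst (lval (map config w)) (int n)"
    "snd (lval (map config w)) = 1"
    using m by (auto simp: val g_val n_def)
  obtain u v where "map config w = u @ v" "length u = m" "\<forall>x\<in>set u. snd x = - 1"
    using short(1)[OF lit(3,1,2)] by blast
  then obtain u' v' where uv: "w = u' @ v'" "length u' = m" "\<forall>x\<in>set u'. snd (config x) = - 1"
    by (auto simp: map_eq_append_conv)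
  obtain q where q: "q \<in> accepting M" "run M (start M) (u' @ v') q"
    using w(1) uv(1) by (auto simp: accepted_language_def simp flip: L)
  obtain x y z where xyz: "u' = x @ y @ z" "y \<noteq> []"
    "run M (start M) (x @ y @ y @ y @ z @ v') q"
    using pumping[OF M st(1) q(2)] uv(2) m_def by auto
  let ?p = "x @ y @ y @ y @ z @ v'"
  have "?p \<in> L"
    using q(1) xyz(3) by (auto simp: accepted_language_def simp flip: L)
  then have p: "geodesic L2 automata_gens ?p"
    by (rule geo)
  let ?c = "map config"
  have w_split: "?c w = ?c x @ ?c y @ ?c (z @ v')"
    by (simp add: uv(1) xyz(1))
  have "\<exists>s \<in> lists letters. lval s = lval (?c x @ ?c y @ ?c y @ ?c y @ ?c (z @ v'))
      \<and> length s < length (?c x @ ?c y @ ?c y @ ?c y @ ?c (z @ v'))"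
  proof (rule pumped_word_shortcut[where m = m and n = n], unfold w_split[symmetric])
    show "\<forall>c\<in>set (?c x @ ?c y). snd c = - 1"
      using uv(3) xyz(1) by auto
    show "length (?c x @ ?c y) \<le> m"
      using uv(2) xyz(1) by simp
    show "- int m < i \<and> i \<le> int n" if "fst (lval (?c w)) i" for i
      using that by (auto simp: val g_val)
  qed (use w_letters xyz(2) lit(3) short(2)[OF lit(3,1,2)] in \<open>simp_all add: n_def\<close>)
  then obtain s where "s \<in> lists letters" "lval s = lval (?c ?p)" "length s < length ?p"
    by auto
  then show False
    using geodesic_length_le[OF p] by fastforce
qed

end
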